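(* Let $0<a<b$ and let $f:[a,b]\to\mathbb{R}$ be nonnegative, continuous, differentiable and strictly monotone on $[a,b]$. Let $[c,d]=f([a,b])$ (with $c<d$) be the range of $f$, and let $g:[c,d]\to[a,b]$ be the inverse function of $f$, so that $x=g(y)$ if and only if $y=f(x)$. Then $$\pi\int_c^d [g(y)]^2\,dy=\operatorname{sgn}(f(b)-f(a))\left\{\pi\left[b^2f(b)-a^2f(a)\right]-2\pi\int_a^b x f(x)\,dx\right\}$$ and $$\pi\int_a^b [f(x)]^2\,dx=\operatorname{sgn}(g(d)-g(c))\left\{\pi\left[d^2g(d)-c^2g(c)\right]-2\pi\int_c^d y\, g(y)\,dy\right\}.$$
   Context: $\operatorname{sgn}$ denotes the sign function: $\operatorname{sgn}(t)=1$ for $t>0$, $\operatorname{sgn}(0)=0$, $\operatorname{sgn}(t)=-1$ for $t<0$. *)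

theory Defs
  imports "HOL-Analysis.Analysis"
begin

end

theory Submission
  imports Defs
begin

text \<open>
  Both formulas are instances of one integration by parts along the graph of \<open>f\<close>. Take the
  boundary term \<open>P x * Q (f x)\<close>, where \<open>p\<close> and \<open>q\<close> are the derivatives of \<open>P\<close> and \<open>Q\<close>. Its
  differential is \<open>p x * Q y dx + P x * q y dy\<close>. Substituting \<open>y = f x\<close> in the first part and
  \<open>x = g y\<close> in the second gives the identity
  \<open>P b * Q (f b) - P a * Q (f a) = \<integral>p x * Q (f x) dx + \<integral>P (g y) * q y dy\<close>,
  with \<open>x\<close> running from \<open>a\<close> to \<open>b\<close> and \<open>y\<close> from \<open>f a\<close> to \<open>f b\<close> (lemma \<open>parts_along_graph\<close>).
  The choice \<open>P x = x\<^sup>2\<close>, \<open>Q y = y\<close> gives the first formula, and \<open>P x = x\<close>, \<open>Q y = y\<^sup>2\<close>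
  gives the second. The sign in the theorem is the orientation of the last integral:
  \<open>(f a, f b)\<close> is \<open>(c, d)\<close> when \<open>f\<close> increases and \<open>(d, c)\<close> when it decreases.

  The derivative of \<open>f\<close> need not be continuous, or even bounded, so the integral of
  \<open>P x * q (f x) * f' x\<close> that a change of variables would produce is avoided. Instead, both
  integrals are viewed as functions of an upper limit tied to \<open>x\<close>, and the difference of the
  two sides then has derivative zero.
\<close>

text \<open>
  The oriented integral from \<open>f a\<close> to \<open>f b\<close> appears as a difference of integrals from \<open>c\<close>, so
  that increasing and decreasing \<open>f\<close> need no separate treatment.
\<close>

lemma parts_along_graph:
  fixes a b c d :: real and f g P p Q q :: "real \<Rightarrow> real"
  assumes ab: "a \<le> b"
    and diff: "f differentiable_on {a..b}"
    and img: "f ` {a..b} = {c..d}"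
    and contg: "continuous_on {c..d} g"
    and gf: "\<And>x. x \<in> {a..b} \<Longrightarrow> g (f x) = x"
    and P: "\<And>x. x \<in> {a..b} \<Longrightarrow> (P has_real_derivative p x) (at x within {a..b})"
    and contp: "continuous_on {a..b} p"
    and Q: "\<And>y. y \<in> {c..d} \<Longrightarrow> (Q has_real_derivative q y) (at y within {c..d})"
    and contq: "continuous_on {c..d} q"
  shows "P b * Q (f b) - P a * Q (f a)
    = integral {a..b} (\<lambda>x. p x * Q (f x))
      + (integral {c..f b} (\<lambda>y. P (g y) * q y) - integral {c..f a} (\<lambda>y. P (g y) * q y))"
proof -
  define H where "H = (\<lambda>y. integral {c..y} (\<lambda>y. P (g y) * q y))"
  define I where "I = (\<lambda>x. integral {a..x} (\<lambda>x. p x * Q (f x)))"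
  define D where "D = (\<lambda>x. P x * Q (f x) - I x - H (f x))"
  have contf: "continuous_on {a..b} f"
    using diff by (rule differentiable_imp_continuous_on)
  have contP: "continuous_on {a..b} P"
    using P by (rule DERIV_continuous_on)
  have contQ: "continuous_on {c..d} Q"
    using Q by (rule DERIV_continuous_on)
  have g_img: "g ` {c..d} = {a..b}"
    using gf by (force simp flip: img)
  have contH: "continuous_on {c..d} (\<lambda>y. P (g y) * q y)"
    by (intro continuous_on_mult contq continuous_on_compose2[OF contP contg]) (simp add: g_img)
  have contI: "continuous_on {a..b} (\<lambda>x. p x * Q (f x))"
    by (intro continuous_on_mult contp continuous_on_compose2[OF contQ contf]) (simp add: img)
  have "(D has_real_derivative 0) (at x within {a..b})" if x: "x \<in> {a..b}" for x
  proof -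
    obtain f' where f': "(f has_real_derivative f') (at x within {a..b})"
      using diff x unfolding differentiable_on_def real_differentiable_def by blast
    have fx: "f x \<in> {c..d}"
      using x img by blast
    have "((\<lambda>x. Q (f x)) has_real_derivative q (f x) * f') (at x within {a..b})"
      using DERIV_image_chain[of Q "q (f x)" f x "{a..b}" f'] Q[OF fx] f'
      by (simp add: img o_def)
    moreover have "((\<lambda>x. H (f x)) has_real_derivative P x * q (f x) * f') (at x within {a..b})"
      using DERIV_image_chain[of H "P x * q (f x)" f x "{a..b}" f'] f'
        integral_has_real_derivative[OF contH fx]
      by (simp add: img o_def H_def gf[OF x])
    moreover have "(I has_real_derivative p x * Q (f x)) (at x within {a..b})"
      unfolding I_def by (rule integral_has_real_derivative[OF contI x])
    ultimately show ?thesis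
      unfolding D_def using P[OF x]
      by (auto intro!: derivative_eq_intros simp: algebra_simps)
  qed
  then obtain k where k: "\<And>x. x \<in> {a..b} \<Longrightarrow> D x = k"
    using has_field_derivative_zero_constant[of "{a..b}" D] by auto
  have "D a = D b"
    using ab k by simp
  moreover have "I a = 0"
    by (simp add: I_def)
  ultimately show ?thesis
    by (simp add: D_def H_def I_def)
qed

theorem theorem1:
  fixes a b c d :: real and f g :: "real \<Rightarrow> real"
  assumes "0 < a" and "a < b"
    and "\<And>x. x \<in> {a..b} \<Longrightarrow> 0 \<le> f x"
    and "continuous_on {a..b} f"
    and "f differentiable_on {a..b}"
    and "strict_mono_on {a..b} f \<or> strict_antimono_on {a..b} f"
    and "c < d" and "f ` {a..b} = {c..d}"
    and "g \<in> {c..d} \<rightarrow> {a..b}"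
    and "\<And>x y. x \<in> {a..b} \<Longrightarrow> y \<in> {c..d} \<Longrightarrow> x = g y \<longleftrightarrow> y = f x"
  shows "pi * integral {c..d} (\<lambda>y. (g y)\<^sup>2)
           = sgn (f b - f a) *
               (pi * (b\<^sup>2 * f b - a\<^sup>2 * f a) - 2 * pi * integral {a..b} (\<lambda>x. x * f x))
       \<and> pi * integral {a..b} (\<lambda>x. (f x)\<^sup>2)
           = sgn (g d - g c) *
               (pi * (d\<^sup>2 * g d - c\<^sup>2 * g c) - 2 * pi * integral {c..d} (\<lambda>y. y * g y))"
proof -
  have gf: "g (f x) = x" if "x \<in> {a..b}" for x
    using that assms(8,10) by (metis imageI)
  have contg: "continuous_on {c..d} g"
    using continuous_on_inv[OF assms(4), of g] gf assms(8) by auto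
  have mem: "f a \<in> {c..d}" "f b \<in> {c..d}" "c \<in> f ` {a..b}" "d \<in> f ` {a..b}"
    using assms(2,7,8) by auto
  have ends: "f a = c \<and> f b = d \<or> f a = d \<and> f b = c"
    using assms(6)
  proof
    assume "strict_mono_on {a..b} f"
    then have "f a \<le> f x \<and> f x \<le> f b" if "x \<in> {a..b}" for x
      using that assms(2) by (auto dest!: strict_mono_on_imp_mono_on intro: mono_onD)
    then show ?thesis
      using mem by force
  next
    assume "strict_antimono_on {a..b} f"
    then have "f b \<le> f x \<and> f x \<le> f a" if "x \<in> {a..b}" for x
      using that assms(2) by (force simp: monotone_on_def le_less)
    then show ?thesis
      using mem by force
  qed
  have g_ends: "g (f a) = a" "g (f b) = b"
    using gf assms(2) by auto
  have square: "((\<lambda>x. x\<^sup>2) has_real_derivative 2 * x) (at x within A)" for x :: real and A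
    by (auto intro!: derivative_eq_intros)
  have first: "b\<^sup>2 * f b - a\<^sup>2 * f a = 2 * integral {a..b} (\<lambda>x. x * f x)
      + (integral {c..f b} (\<lambda>y. (g y)\<^sup>2) - integral {c..f a} (\<lambda>y. (g y)\<^sup>2))"
    using parts_along_graph[of a b f c d g "\<lambda>x. x\<^sup>2" "\<lambda>x. 2 * x" "\<lambda>y. y" "\<lambda>y. 1"]
      assms(2,5,8) contg gf square
    by (auto simp: mult.assoc intro!: derivative_eq_intros continuous_intros)
  have second: "b * (f b)\<^sup>2 - a * (f a)\<^sup>2 = integral {a..b} (\<lambda>x. (f x)\<^sup>2)
      + (2 * integral {c..f b} (\<lambda>y. y * g y) - 2 * integral {c..f a} (\<lambda>y. y * g y))"
    using parts_along_graph[of a b f c d g "\<lambda>x. x" "\<lambda>x. 1" "\<lambda>y. y\<^sup>2" "\<lambda>y. 2 * y"]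
      assms(2,5,8) contg gf square
    by (auto simp: mult.assoc mult.commute[of "g _"]
        intro!: derivative_eq_intros continuous_intros)
  show ?thesis
    using ends
  proof
    assume *: "f a = c \<and> f b = d"
    then have "g c = a" "g d = b"
      using g_ends by auto
    with * first second assms(2,7) show ?thesis
      by (simp add: algebra_simps)
  next
    assume *: "f a = d \<and> f b = c"
    then have "g d = a" "g c = b"
      using g_ends by auto
    with * first second
    have g_sq: "integral {c..d} (\<lambda>y. (g y)\<^sup>2) = a\<^sup>2 * d - b\<^sup>2 * c + 2 * integral {a..b} (\<lambda>x. x * f x)"
      and f_sq: "integral {a..b} (\<lambda>x. (f x)\<^sup>2) = b * c\<^sup>2 - a * d\<^sup>2 + 2 * integral {c..d} (\<lambda>y. y * g y)"
      by simp_all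
    show ?thesis
      using * \<open>g d = a\<close> \<open>g c = b\<close> assms(2,7) by (simp add: g_sq f_sq algebra_simps)
  qed
qed

end
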